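(* Let $|H_n^{k_{max}}\rangle$ be the $n$-qubit hypergraph state of a connected hypergraph on $n$ vertices whose maximum hyperedge cardinality equals $k_{max}$. Then its overlap with the pure biseparable states is upper bounded by $$\alpha(|H_n^{k_{max}}\rangle)\le\frac{2^{k_{max}-1}-1}{2^{k_{max}-1}},$$ and hence its multipartite entanglement is lower bounded by $$E(|H_n^{k_{max}}\rangle)\ge\frac{1}{2^{k_{max}-1}}.$$
   Context: Throughout, $n\ge 2$ is the number of qubits, so the Hilbert space is $(\mathbb{C}^2)^{\otimes n}$ with computational basis $|x\rangle$, $x\in\{0,1\}^n$, and $|+\rangle=(|0\rangle+|1\rangle)/\sqrt2$. A hypergraph $H=(V,E)$ of order $n$ has vertex set $V=\{1,\dots,n\}$ and a set $E$ of nonempty subsets of $V$ (hyperedges, of arbitrary cardinalities). It is connected if for every partition of $V$ into two nonempty sets $A,B$ some hyperedge meets both $A$ and $B$. For a nonempty set $e\subseteq V$ with $|e|=k$, $C^{e}=C_k^{e}$ is the $k$-qubit controlled-$Z$ gate acting on the qubits in $e$ (identity on the others): the diagonal operator with $C^e|x\rangle=-|x\rangle$ if $x_j=1$ for all $j\in e$, and $C^e|x\rangle=|x\rangle$ otherwise. The hypergraph state of $H$ is $|H\rangle=\prod_{e\in E}C^{e}\,|+\rangle^{\otimes n}$ (the gates commute). Overlap and multipartite entanglement: for a normalized pure state $|\psi\rangle$ of $n$ qubits and a bipartition $A\,|\,B$ of the set of qubits into two nonempty disjoint sets with union $\{1,\dots,n\}$, let $\alpha^{AB}(|\psi\rangle)=\max|\langle\phi^A|\langle\phi^B|\psi\rangle|^2$,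 the maximum being over all normalized pure states $|\phi^A\rangle$ of the qubits in $A$ and $|\phi^B\rangle$ of the qubits in $B$. Define $\alpha(|\psi\rangle)=\max_{AB}\alpha^{AB}(|\psi\rangle)$ over all such bipartitions, and the multipartite entanglement $E(|\psi\rangle)=1-\alpha(|\psi\rangle)$. The pure biseparable states are the product states $|\phi^A\rangle|\phi^B\rangle$ over all bipartitions. *)

theory Defs
  imports "HOL-Analysis.Analysis"
begin

section \<open>States of a finite set of qubits\<close>

definition bitstrings :: "nat set \<Rightarrow> (nat \<Rightarrow> nat) set" where
  "bitstrings A = (A \<rightarrow>\<^sub>E {0, 1})"

text \<open>
  A state of the qubits in a finite set \<open>A\<close> is given by its amplitudes
  \<open>\<langle>x|\<psi>\<rangle>\<close>, \<open>x \<in> {0,1}\<^sup>A\<close>. Only the values on \<^term>\<open>bitstrings A\<close> are meaningful;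
  every notion below depends on these values alone.
\<close>

type_synonym state = "(nat \<Rightarrow> nat) \<Rightarrow> complex"

definition braket :: "nat set \<Rightarrow> state \<Rightarrow> state \<Rightarrow> complex" where
  "braket A \<phi> \<psi> = (\<Sum>x\<in>bitstrings A. cnj (\<phi> x) * \<psi> x)"

definition normalized :: "nat set \<Rightarrow> state \<Rightarrow> bool" where
  "normalized A \<phi> \<longleftrightarrow> braket A \<phi> \<phi> = 1"

definition tensor :: "nat set \<Rightarrow> nat set \<Rightarrow> state \<Rightarrow> state \<Rightarrow> state" where
  "tensor A B \<phi> \<xi> = (\<lambda>x. \<phi> (restrict x A) * \<xi> (restrict x B))"


section \<open>Hypergraphs and hypergraph states\<close>

definition hypergraph :: "nat \<Rightarrow> nat set set \<Rightarrow> bool" where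
  "hypergraph n E \<longleftrightarrow> (\<forall>e\<in>E. e \<noteq> {} \<and> e \<subseteq> {1..n})"

definition bipartition :: "nat \<Rightarrow> nat set \<Rightarrow> nat set \<Rightarrow> bool" where
  "bipartition n A B \<longleftrightarrow> A \<noteq> {} \<and> B \<noteq> {} \<and> A \<inter> B = {} \<and> A \<union> B = {1..n}"

definition connected_hypergraph :: "nat \<Rightarrow> nat set set \<Rightarrow> bool" where
  "connected_hypergraph n E \<longleftrightarrow>
     (\<forall>A B. bipartition n A B \<longrightarrow> (\<exists>e\<in>E. e \<inter> A \<noteq> {} \<and> e \<inter> B \<noteq> {}))"

definition max_cardinality :: "nat set set \<Rightarrow> nat" where
  "max_cardinality E = Max (card ` E)"

definition ket :: "'a \<Rightarrow> 'a \<Rightarrow> complex" where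
  "ket x = (\<lambda>y. if y = x then 1 else 0)"

definition plus_qubit :: "nat \<Rightarrow> complex" where
  "plus_qubit b = (ket 0 b + ket 1 b) / complex_of_real (sqrt 2)"

definition plus_state :: "nat \<Rightarrow> state" where
  "plus_state n = (\<lambda>x. \<Prod>j\<in>{1..n}. plus_qubit (x j))"

definition CZ :: "nat set \<Rightarrow> state \<Rightarrow> state" where
  "CZ e \<psi> = (\<lambda>x. if \<forall>j\<in>e. x j = 1 then - \<psi> x else \<psi> x)"

lemma CZ_ket: "CZ e (ket x) = (if \<forall>j\<in>e. x j = 1 then - ket x else ket x)"
  by (auto simp: CZ_def ket_def fun_eq_iff)

lemma comp_fun_commute_CZ: "comp_fun_commute CZ"
  by unfold_locales (auto simp: CZ_def fun_eq_iff)

text \<open>By the commutation of the gates, the fold applies every gate \<open>C\<^sup>e\<close>, \<open>e \<in> E\<close>, exactly once.\<close>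

definition hypergraph_state :: "nat \<Rightarrow> nat set set \<Rightarrow> state" where
  "hypergraph_state n E = Finite_Set.fold CZ (plus_state n) E"


section \<open>Overlap with biseparable states and multipartite entanglement\<close>

definition bipartite_overlaps :: "nat set \<Rightarrow> nat set \<Rightarrow> state \<Rightarrow> real set" where
  "bipartite_overlaps A B \<psi> =
     {(cmod (braket (A \<union> B) (tensor A B \<phi> \<xi>) \<psi>))\<^sup>2 | \<phi> \<xi>. normalized A \<phi> \<and> normalized B \<xi>}"

text \<open>
  The supremum is a maximum for finite \<open>A\<close> and \<open>B\<close>:
  see \<open>bipartite_overlap_attained\<close> and \<open>bipartite_overlap_upper\<close> below.
\<close>

definition bipartite_overlap :: "nat set \<Rightarrow> nat set \<Rightarrow> state \<Rightarrow> real" where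
  "bipartite_overlap A B \<psi> = Sup (bipartite_overlaps A B \<psi>)"

definition overlap :: "nat \<Rightarrow> state \<Rightarrow> real" where
  "overlap n \<psi> = Max {bipartite_overlap A B \<psi> | A B. bipartition n A B}"

definition entanglement :: "nat \<Rightarrow> state \<Rightarrow> real" where
  "entanglement n \<psi> = 1 - overlap n \<psi>"

lemma finite_bitstrings: "finite A \<Longrightarrow> finite (bitstrings A)"
  by (simp add: bitstrings_def finite_PiE)

definition unit_sphere :: "nat set \<Rightarrow> state set" where
  "unit_sphere A = {\<phi>. normalized A \<phi> \<and> (\<forall>x. x \<notin> bitstrings A \<longrightarrow> \<phi> x = 0)}"

lemma normalized_iff: "normalized A \<phi> \<longleftrightarrow> (\<Sum>x\<in>bitstrings A. (cmod (\<phi> x))\<^sup>2) = 1"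
proof -
  have "braket A \<phi> \<phi> = of_real (\<Sum>x\<in>bitstrings A. (cmod (\<phi> x))\<^sup>2)"
    by (simp only: braket_def of_real_sum complex_norm_square mult.commute)
  then show ?thesis
    by (simp only: normalized_def of_real_eq_1_iff)
qed

lemma compact_unit_sphere:
  assumes "finite A"
  shows "compact (unit_sphere A)"
proof -
  define K :: "state set" where
    "K = (\<Pi>\<^sub>E x\<in>UNIV. if x \<in> bitstrings A then cball 0 1 else {0})"
  have "compactin (product_topology (\<lambda>_. euclidean) UNIV) K"
    unfolding K_def by (subst compactin_PiE) auto
  then have K: "compact K"
    by (simp add: euclidean_product_topology)
  have "closed {\<phi>::state. (\<Sum>x\<in>bitstrings A. (cmod (\<phi> x))\<^sup>2) = 1}"
    by (intro closed_Collect_eq continuous_on_sum continuous_on_power continuous_on_norm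
          continuous_on_product_coordinates continuous_on_const)
  with K have *: "compact (K \<inter> {\<phi>. (\<Sum>x\<in>bitstrings A. (cmod (\<phi> x))\<^sup>2) = 1})"
    by (rule compact_Int_closed)
  have "cmod (\<phi> x) \<le> 1"
    if "(\<Sum>x\<in>bitstrings A. (cmod (\<phi> x))\<^sup>2) = 1" "x \<in> bitstrings A" for \<phi> :: state and x
  proof -
    have "(cmod (\<phi> x))\<^sup>2 \<le> 1"
      using member_le_sum[OF that(2), of "\<lambda>x. (cmod (\<phi> x))\<^sup>2"] that(1)
        finite_bitstrings[OF assms] by simp
    then show ?thesis
      by (simp add: power_le_one_iff abs_square_le_1)
  qed
  then have "unit_sphere A = K \<inter> {\<phi>. (\<Sum>x\<in>bitstrings A. (cmod (\<phi> x))\<^sup>2) = 1}"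
    by (auto simp: unit_sphere_def K_def normalized_iff PiE_def Pi_iff split: if_splits)
  with * show ?thesis by simp
qed

lemma unit_sphere_nonempty:
  assumes "finite A"
  shows "unit_sphere A \<noteq> {}"
proof -
  define z :: "nat \<Rightarrow> nat" where "z = restrict (\<lambda>_. 0) A"
  have z: "z \<in> bitstrings A"
    by (auto simp: z_def bitstrings_def)
  have "(\<Sum>x\<in>bitstrings A. (cmod (ket z x))\<^sup>2) = (\<Sum>x\<in>bitstrings A. if x = z then 1 else 0)"
    by (intro sum.cong) (auto simp: ket_def)
  also have "\<dots> = 1"
    using z finite_bitstrings[OF assms] by simp
  finally have "ket z \<in> unit_sphere A"
    using z by (auto simp: unit_sphere_def normalized_iff ket_def)
  then show ?thesis by blast
qed

lemma bipartite_overlaps_eq_image: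
  "bipartite_overlaps A B \<psi> =
     (\<lambda>(\<phi>, \<xi>). (cmod (braket (A \<union> B) (tensor A B \<phi> \<xi>) \<psi>))\<^sup>2) ` (unit_sphere A \<times> unit_sphere B)"
    (is "_ = ?f ` _")
proof (rule set_eqI, rule iffI)
  fix t assume "t \<in> bipartite_overlaps A B \<psi>"
  then obtain \<phi> \<xi> where t: "t = ?f (\<phi>, \<xi>)" and n: "normalized A \<phi>" "normalized B \<xi>"
    by (auto simp: bipartite_overlaps_def)
  define c where "c = (\<lambda>A (\<phi>::state) x. if x \<in> bitstrings A then \<phi> x else 0)"
  have "c A \<phi> \<in> unit_sphere A" "c B \<xi> \<in> unit_sphere B"
    using n by (auto simp: unit_sphere_def normalized_def braket_def c_def)
  moreover have "t = ?f (c A \<phi>, c B \<xi>)"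
  proof -
    have "restrict x A \<in> bitstrings A" "restrict x B \<in> bitstrings B"
      if "x \<in> bitstrings (A \<union> B)" for x
      using that by (auto simp: bitstrings_def PiE_def Pi_iff)
    then have "braket (A \<union> B) (tensor A B \<phi> \<xi>) \<psi> = braket (A \<union> B) (tensor A B (c A \<phi>) (c B \<xi>)) \<psi>"
      unfolding braket_def tensor_def by (intro sum.cong) (auto simp: c_def)
    then show ?thesis by (simp add: t)
  qed
  ultimately show "t \<in> ?f ` (unit_sphere A \<times> unit_sphere B)" by blast
qed (auto simp: bipartite_overlaps_def unit_sphere_def)

lemma bipartite_overlaps_max:
  assumes "finite A" "finite B"
  shows "\<exists>s\<in>bipartite_overlaps A B \<psi>. \<forall>t\<in>bipartite_overlaps A B \<psi>. t \<le> s"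
  unfolding bipartite_overlaps_eq_image
proof (rule compact_attains_sup)
  note * = continuous_on_product_then_coordinatewise[OF continuous_on_fst[OF continuous_on_id]]
    continuous_on_product_then_coordinatewise[OF continuous_on_snd[OF continuous_on_id]]
  have "continuous_on UNIV (\<lambda>(\<phi>, \<xi>). (cmod (braket (A \<union> B) (tensor A B \<phi> \<xi>) \<psi>))\<^sup>2)"
    unfolding braket_def tensor_def case_prod_unfold
    by (intro continuous_on_power continuous_on_norm continuous_on_sum continuous_on_mult
          continuous_on_cnj continuous_on_const *)
  then show "compact ((\<lambda>(\<phi>, \<xi>). (cmod (braket (A \<union> B) (tensor A B \<phi> \<xi>) \<psi>))\<^sup>2)
          ` (unit_sphere A \<times> unit_sphere B))"
    by (intro compact_continuous_image compact_Times compact_unit_sphere assms)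
      (rule continuous_on_subset, auto)
qed (use unit_sphere_nonempty assms in auto)

lemma bipartite_overlap_attained:
  assumes "finite A" "finite B"
  shows "bipartite_overlap A B \<psi> \<in> bipartite_overlaps A B \<psi>"
  using bipartite_overlaps_max[OF assms, of \<psi>]
  by (metis bipartite_overlap_def cSup_eq_maximum)

lemma bipartite_overlap_upper:
  assumes "finite A" "finite B" "t \<in> bipartite_overlaps A B \<psi>"
  shows "t \<le> bipartite_overlap A B \<psi>"
  using bipartite_overlaps_max[OF assms(1,2), of \<psi>] assms(3)
  by (metis bipartite_overlap_def cSup_eq_maximum)

end

theory Submission
  imports Defs
begin

text \<open>
  Fix a bipartition \<open>A | B\<close> and a hyperedge \<open>e\<close> that is inclusion-maximal among those meeting both
  sides. Fixing the bits outside \<open>e\<close> cuts the matrix of amplitudes into blocks of size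
  \<open>2^|A \<inter> e| \<times> 2^|B \<inter> e|\<close>. By maximality, \<open>e\<close> is the only gate whose number of sign flips in a
  block is odd, so the product of all signs of a block is \<open>-1\<close>. Hence every row has a partner row
  such that the product of the two has an odd number of minus signs, and their inner product is at
  most the row length minus \<open>2\<close> in absolute value. Bounding the largest eigenvalue of the Gram matrix
  by the largest absolute row sum shows that the squared norm of a block is at most \<open>2^|e| - 2\<close>, and
  Cauchy-Schwarz over the blocks bounds the overlap by \<open>1 - 2 / 2^|e|\<close>.
\<close>

section \<open>Sign matrices\<close>

text \<open>If every sign were \<open>- c\<close>, the product would be an even power of
  \<open>- c\<close>, which is 1.\<close>

lemma prod_signs_both:
  fixes f :: "'a \<Rightarrow> real"
  assumes sgn: "\<And>i. i \<in> I \<Longrightarrow> f i = 1 \<or> f i = -1"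
    and ev: "even (card I)" and pr: "prod f I = -1"
    and c: "c = 1 \<or> c = -1"
  shows "\<exists>i\<in>I. f i = c"
proof (rule ccontr)
  assume "\<not> ?thesis"
  then have "f i = - c" if "i \<in> I" for i
    using sgn[OF that] c that by auto
  then have "prod f I = (- c) ^ card I"
    by simp
  also have "\<dots> = 1"
    using ev c by auto
  finally show False using pr by simp
qed

text \<open>Both signs occur, so \<open>sum f I\<close> and its negative each contain a term -1;
  bounding the other terms by 1 loses 2 against the trivial bound.\<close>

lemma abs_sum_signs_le:
  fixes f :: "'a \<Rightarrow> real"
  assumes fin: "finite I" and sgn: "\<And>i. i \<in> I \<Longrightarrow> f i = 1 \<or> f i = -1"
    and ev: "even (card I)" and pr: "prod f I = -1"
  shows "\<bar>sum f I\<bar> \<le> real (card I) - 2"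
proof -
  have *: "c * sum f I \<le> real (card I) - 2" if c: "c = 1 \<or> c = -1" for c
  proof -
    obtain i where i: "i \<in> I" "f i = - c"
      using prod_signs_both[OF sgn ev pr, of "- c"] c by auto
    have "(\<Sum>j\<in>I - {i}. c * f j) \<le> (\<Sum>j\<in>I - {i}. 1)"
      using sgn c by (intro sum_mono) fastforce
    also have "\<dots> = (\<Sum>j\<in>I. 1) - 1"
      using fin i by (simp only: sum.remove)
    finally have "(\<Sum>j\<in>I - {i}. c * f j) \<le> real (card I) - 1"
      by simp
    moreover have "c * f i = -1"
      using i c by auto
    moreover have "c * sum f I = c * f i + (\<Sum>j\<in>I - {i}. c * f j)"
      unfolding sum_distrib_left using fin i by (simp only: sum.remove)
    ultimately show ?thesis by simp
  qed
  show ?thesis using *[of 1] *[of "-1"] by simp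
qed

section \<open>Bilinear forms bounded through the Gram matrix\<close>

text \<open>The left side is the Hermitian form of the Gram matrix of the rows of \<open>F\<close>.
  That the largest absolute row sum dominates this form is the Gershgorin bound, obtained here from
  the arithmetic-geometric mean inequality without eigenvalues.\<close>

lemma gram_quadratic_form_le:
  fixes u :: "'a \<Rightarrow> complex" and F :: "'a \<Rightarrow> 'b \<Rightarrow> real"
  assumes row: "\<And>i. i \<in> I \<Longrightarrow> (\<Sum>i'\<in>I. \<bar>\<Sum>j\<in>J. F i j * F i' j\<bar>) \<le> C"
  shows "(\<Sum>j\<in>J. (cmod (\<Sum>i\<in>I. u i * of_real (F i j)))\<^sup>2) \<le> C * (\<Sum>i\<in>I. (cmod (u i))\<^sup>2)"
proof -
  define G where "G i i' = (\<Sum>j\<in>J. F i j * F i' j)" for i i'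
  have sym: "G i i' = G i' i" for i i'
    by (simp add: G_def mult.commute)
  have "complex_of_real (\<Sum>j\<in>J. (cmod (\<Sum>i\<in>I. u i * of_real (F i j)))\<^sup>2)
      = (\<Sum>j\<in>J. (\<Sum>i\<in>I. u i * of_real (F i j)) * cnj (\<Sum>i\<in>I. u i * of_real (F i j)))"
    by (simp only: of_real_sum complex_norm_square)
  also have "\<dots> = (\<Sum>j\<in>J. \<Sum>i\<in>I. \<Sum>i'\<in>I. u i * cnj (u i') * of_real (F i j * F i' j))"
    by (simp add: sum_product mult_ac)
  also have "\<dots> = (\<Sum>i\<in>I. \<Sum>i'\<in>I. \<Sum>j\<in>J. u i * cnj (u i') * of_real (F i j * F i' j))"
    by (subst sum.swap, rule sum.cong[OF refl], subst sum.swap, rule refl)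
  also have "\<dots> = (\<Sum>i\<in>I. \<Sum>i'\<in>I. u i * cnj (u i') * of_real (G i i'))"
    unfolding G_def of_real_sum by (simp only: sum_distrib_left)
  finally have eq: "complex_of_real (\<Sum>j\<in>J. (cmod (\<Sum>i\<in>I. u i * of_real (F i j)))\<^sup>2) = \<dots>" .
  \<comment> \<open>A real number is at most its modulus, which allows the triangle inequality on
    the complex expansion \<open>eq\<close>.\<close>
  have "(\<Sum>j\<in>J. (cmod (\<Sum>i\<in>I. u i * of_real (F i j)))\<^sup>2)
      \<le> cmod (complex_of_real (\<Sum>j\<in>J. (cmod (\<Sum>i\<in>I. u i * of_real (F i j)))\<^sup>2))"
    unfolding norm_of_real by simp
  also have "\<dots> \<le> (\<Sum>i\<in>I. \<Sum>i'\<in>I. cmod (u i) * cmod (u i') * \<bar>G i i'\<bar>)"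
    unfolding eq by (intro sum_norm_le) (simp add: norm_mult)
  \<comment> \<open>The mean inequality separates \<open>u i\<close> from \<open>u i'\<close>; by
    symmetry of \<open>G\<close> the two resulting sums agree, and only row sums of \<open>G\<close>
    remain.\<close>
  also have "\<dots> \<le> (\<Sum>i\<in>I. \<Sum>i'\<in>I. ((cmod (u i))\<^sup>2 * \<bar>G i i'\<bar> + (cmod (u i'))\<^sup>2 * \<bar>G i i'\<bar>) / 2)"
  proof (intro sum_mono)
    fix i i'
    have "cmod (u i) * cmod (u i') * \<bar>G i i'\<bar> \<le> ((cmod (u i))\<^sup>2 + (cmod (u i'))\<^sup>2) / 2 * \<bar>G i i'\<bar>"
      using sum_squares_bound[of "cmod (u i)" "cmod (u i')"] by (intro mult_right_mono) auto
    then show "cmod (u i) * cmod (u i') * \<bar>G i i'\<bar>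
        \<le> ((cmod (u i))\<^sup>2 * \<bar>G i i'\<bar> + (cmod (u i'))\<^sup>2 * \<bar>G i i'\<bar>) / 2"
      by (simp add: algebra_simps)
  qed
  also have "\<dots> = ((\<Sum>i\<in>I. \<Sum>i'\<in>I. (cmod (u i))\<^sup>2 * \<bar>G i i'\<bar>)
      + (\<Sum>i\<in>I. \<Sum>i'\<in>I. (cmod (u i'))\<^sup>2 * \<bar>G i i'\<bar>)) / 2"
    by (simp add: sum.distrib sum_divide_distrib[symmetric])
  also have "(\<Sum>i\<in>I. \<Sum>i'\<in>I. (cmod (u i'))\<^sup>2 * \<bar>G i i'\<bar>) = (\<Sum>i\<in>I. \<Sum>i'\<in>I. (cmod (u i))\<^sup>2 * \<bar>G i i'\<bar>)"
    by (subst sum.swap) (simp add: sym)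
  also have "(\<dots> + \<dots>) / 2 = (\<Sum>i\<in>I. (cmod (u i))\<^sup>2 * (\<Sum>i'\<in>I. \<bar>G i i'\<bar>))"
    by (simp add: sum_distrib_left[symmetric])
  also have "\<dots> \<le> (\<Sum>i\<in>I. (cmod (u i))\<^sup>2 * C)"
    using row by (intro sum_mono mult_left_mono) (auto simp: G_def)
  finally show ?thesis
    by (simp add: sum_distrib_left mult.commute)
qed

text \<open>Cauchy-Schwarz over \<open>J\<close> splits off \<open>v\<close>; the squared norm of
  the remaining vector \<open>w\<close> is the Gram form of \<open>u\<close>.\<close>

lemma bilinear_form_le:
  fixes u :: "'a \<Rightarrow> complex" and v :: "'b \<Rightarrow> complex" and F :: "'a \<Rightarrow> 'b \<Rightarrow> real"
  assumes row: "\<And>i. i \<in> I \<Longrightarrow> (\<Sum>i'\<in>I. \<bar>\<Sum>j\<in>J. F i j * F i' j\<bar>) \<le> C"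
  shows "(cmod (\<Sum>i\<in>I. \<Sum>j\<in>J. u i * v j * of_real (F i j)))\<^sup>2
    \<le> C * (\<Sum>i\<in>I. (cmod (u i))\<^sup>2) * (\<Sum>j\<in>J. (cmod (v j))\<^sup>2)"
proof -
  define w where "w j = (\<Sum>i\<in>I. u i * of_real (F i j))" for j
  have "(\<Sum>i\<in>I. \<Sum>j\<in>J. u i * v j * of_real (F i j)) = (\<Sum>j\<in>J. w j * v j)"
    unfolding w_def sum_distrib_right by (subst sum.swap) (simp add: mult_ac)
  then have "cmod (\<Sum>i\<in>I. \<Sum>j\<in>J. u i * v j * of_real (F i j)) \<le> (\<Sum>j\<in>J. cmod (w j) * cmod (v j))"
    by (simp add: sum_norm_le norm_mult)
  then have "(cmod (\<Sum>i\<in>I. \<Sum>j\<in>J. u i * v j * of_real (F i j)))\<^sup>2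
      \<le> (\<Sum>j\<in>J. cmod (w j) * cmod (v j))\<^sup>2"
    by (intro power_mono) auto
  also have "\<dots> \<le> (\<Sum>j\<in>J. (cmod (w j))\<^sup>2) * (\<Sum>j\<in>J. (cmod (v j))\<^sup>2)"
    by (rule Cauchy_Schwarz_ineq_sum)
  also have "\<dots> \<le> C * (\<Sum>i\<in>I. (cmod (u i))\<^sup>2) * (\<Sum>j\<in>J. (cmod (v j))\<^sup>2)"
    unfolding w_def by (intro mult_right_mono gram_quadratic_form_le row) (auto simp: sum_nonneg)
  finally show ?thesis .
qed

text \<open>The row sums of the Gram matrix are trivially at most \<open>card I * card J\<close>.
  Oddness of the total product gains 2 in each of them, through one partner row.\<close>

lemma odd_sign_matrix_bound:
  fixes u :: "'a \<Rightarrow> complex" and v :: "'b \<Rightarrow> complex" and F :: "'a \<Rightarrow> 'b \<Rightarrow> real"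
  assumes fin: "finite I" "finite J" and ev: "even (card I)" "even (card J)"
    and sgn: "\<And>i j. i \<in> I \<Longrightarrow> j \<in> J \<Longrightarrow> F i j = 1 \<or> F i j = -1"
    and odd: "(\<Prod>i\<in>I. \<Prod>j\<in>J. F i j) = -1"
  shows "(cmod (\<Sum>i\<in>I. \<Sum>j\<in>J. u i * v j * of_real (F i j)))\<^sup>2
    \<le> (real (card I * card J) - 2) * (\<Sum>i\<in>I. (cmod (u i))\<^sup>2) * (\<Sum>j\<in>J. (cmod (v j))\<^sup>2)"
proof (rule bilinear_form_le)
  fix i assume i: "i \<in> I"
  define r where "r i = (\<Prod>j\<in>J. F i j)" for i
  have r: "r i = 1 \<or> r i = -1" if "i \<in> I" for i
  proof -
    have "(\<Prod>j\<in>K. F i j) = 1 \<or> (\<Prod>j\<in>K. F i j) = -1" if "finite K" "K \<subseteq> J" for K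
      using that by induction (use sgn \<open>i \<in> I\<close> in \<open>auto, (metis mult_1 minus_minus mult_minus1)+\<close>)
    then show ?thesis using fin by (auto simp: r_def)
  qed
  \<comment> \<open>The row products are evenly many signs with product -1, so both signs occur
    among them.\<close>
  obtain i' where i': "i' \<in> I" "r i' = - r i"
    using prod_signs_both[of I r "- r i"] r ev(1) odd r[OF i] by (auto simp: r_def)
  have "(\<Prod>j\<in>J. F i j * F i' j) = -1"
    using r[OF i] i'(2) unfolding prod.distrib r_def[symmetric] by auto
  moreover have "F i j * F i' j = 1 \<or> F i j * F i' j = -1" if "j \<in> J" for j
    using sgn[OF i that] sgn[OF i'(1) that] by auto
  ultimately have 1: "\<bar>\<Sum>j\<in>J. F i j * F i' j\<bar> \<le> real (card J) - 2"
    using abs_sum_signs_le[of J "\<lambda>j. F i j * F i' j"] fin ev by simp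
  have 2: "\<bar>\<Sum>j\<in>J. F i j * F k j\<bar> \<le> real (card J)" if "k \<in> I" for k
  proof -
    have "\<bar>\<Sum>j\<in>J. F i j * F k j\<bar> \<le> (\<Sum>j\<in>J. 1)"
      using sgn[OF i] sgn[OF that]
      by (intro sum_abs[THEN order_trans] sum_mono) (auto simp: abs_mult, fastforce)
    then show ?thesis by simp
  qed
  have "(\<Sum>k\<in>I. \<bar>\<Sum>j\<in>J. F i j * F k j\<bar>)
      = \<bar>\<Sum>j\<in>J. F i j * F i' j\<bar> + (\<Sum>k\<in>I - {i'}. \<bar>\<Sum>j\<in>J. F i j * F k j\<bar>)"
    using fin i' by (simp add: sum.remove)
  also have "\<dots> \<le> (real (card J) - 2) + (\<Sum>k\<in>I - {i'}. real (card J))"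
    using 1 2 by (intro add_mono sum_mono) auto
  also have "\<dots> = (\<Sum>k\<in>I. real (card J)) - 2"
    using fin i' by (simp only: sum.remove)
  finally show "(\<Sum>k\<in>I. \<bar>\<Sum>j\<in>J. F i j * F k j\<bar>) \<le> real (card I * card J) - 2"
    by simp
qed

text \<open>Cauchy-Schwarz against the constant 1 over all pairs of fibres costs a factor equal to
  the number of pairs. The block bounds then add up exactly, since their sum factors into the totals
  of \<open>U\<close> and \<open>V\<close>.\<close>

lemma fibre_bound:
  fixes f :: "'a \<Rightarrow> 'b \<Rightarrow> complex" and U :: "'a \<Rightarrow> real" and V :: "'b \<Rightarrow> real"
  assumes fin: "finite I" "finite J"
    and blk: "\<And>p q. p \<in> g ` I \<Longrightarrow> q \<in> h ` J \<Longrightarrow>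
      (cmod (\<Sum>i\<in>{i\<in>I. g i = p}. \<Sum>j\<in>{j\<in>J. h j = q}. f i j))\<^sup>2
        \<le> c * (\<Sum>i\<in>{i\<in>I. g i = p}. U i) * (\<Sum>j\<in>{j\<in>J. h j = q}. V j)"
  shows "(cmod (\<Sum>i\<in>I. \<Sum>j\<in>J. f i j))\<^sup>2
    \<le> real (card (g ` I) * card (h ` J)) * (c * sum U I * sum V J)"
proof -
  define t where "t p q = (\<Sum>i\<in>{i\<in>I. g i = p}. \<Sum>j\<in>{j\<in>J. h j = q}. f i j)" for p q
  define P where "P = g ` I"
  define Q where "Q = h ` J"
  define U' where "U' p = (\<Sum>i\<in>{i\<in>I. g i = p}. U i)" for p
  define V' where "V' q = (\<Sum>j\<in>{j\<in>J. h j = q}. V j)" for q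
  have "(\<Sum>i\<in>I. \<Sum>j\<in>J. f i j) = (\<Sum>p\<in>P. \<Sum>i\<in>{i\<in>I. g i = p}. \<Sum>j\<in>J. f i j)"
    unfolding P_def using fin(1) by (rule sum.image_gen)
  also have "\<dots> = (\<Sum>p\<in>P. \<Sum>i\<in>{i\<in>I. g i = p}. \<Sum>q\<in>Q. \<Sum>j\<in>{j\<in>J. h j = q}. f i j)"
    unfolding Q_def using fin by (intro sum.cong refl sum.image_gen)
  also have "\<dots> = (\<Sum>p\<in>P. \<Sum>q\<in>Q. t p q)"
    unfolding t_def by (intro sum.cong refl sum.swap)
  also have "\<dots> = (\<Sum>z\<in>P \<times> Q. t (fst z) (snd z))"
    by (simp add: sum.cartesian_product case_prod_unfold)
  finally have "cmod (\<Sum>i\<in>I. \<Sum>j\<in>J. f i j) \<le> (\<Sum>z\<in>P \<times> Q. cmod (t (fst z) (snd z)) * 1)"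
    by (simp add: sum_norm_le)
  then have "(cmod (\<Sum>i\<in>I. \<Sum>j\<in>J. f i j))\<^sup>2 \<le> (\<Sum>z\<in>P \<times> Q. cmod (t (fst z) (snd z)) * 1)\<^sup>2"
    by (intro power_mono) auto
  also have "\<dots> \<le> (\<Sum>z\<in>P \<times> Q. (cmod (t (fst z) (snd z)))\<^sup>2) * (\<Sum>z\<in>P \<times> Q. 1\<^sup>2)"
    by (rule Cauchy_Schwarz_ineq_sum)
  also have "\<dots> \<le> (\<Sum>z\<in>P \<times> Q. c * U' (fst z) * V' (snd z)) * (\<Sum>z\<in>P \<times> Q. 1\<^sup>2)"
    using blk by (intro mult_right_mono sum_mono) (auto simp: t_def U'_def V'_def P_def Q_def)
  also have "(\<Sum>z\<in>P \<times> Q. c * U' (fst z) * V' (snd z)) = (\<Sum>p\<in>P. \<Sum>q\<in>Q. c * U' p * V' q)"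
    by (simp add: sum.cartesian_product case_prod_unfold)
  also have "\<dots> = c * (\<Sum>p\<in>P. U' p) * (\<Sum>q\<in>Q. V' q)"
    by (simp add: sum_product sum_distrib_left mult_ac)
  also have "(\<Sum>p\<in>P. U' p) = sum U I"
    unfolding P_def U'_def using fin by (intro sum.image_gen[symmetric])
  also have "(\<Sum>q\<in>Q. V' q) = sum V J"
    unfolding Q_def V'_def using fin by (intro sum.image_gen[symmetric])
  finally show ?thesis
    by (simp add: card_cartesian_product P_def Q_def mult_ac)
qed


section \<open>Bit strings as subsets\<close>

text \<open>Coding strings by subsets turns joining strings on disjoint sets into a union, and "all
  bits of \<open>e\<close> are 1" into inclusion of \<open>e\<close>.\<close>

definition bits :: "nat set \<Rightarrow> nat set \<Rightarrow> nat \<Rightarrow> nat" where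
  "bits A S = (\<lambda>j\<in>A. if j \<in> S then 1 else 0)"

lemma bij_betw_bits: "bij_betw (bits A) (Pow A) (bitstrings A)"
proof (rule bij_betw_byWitness[where f' = "\<lambda>x. {j\<in>A. x j = 1}"])
  show "\<forall>x\<in>bitstrings A. bits A {j\<in>A. x j = 1} = x"
    by (force simp: bits_def bitstrings_def fun_eq_iff PiE_iff extensional_def)
qed (auto simp: bits_def bitstrings_def split: if_splits)

lemma restrict_bits: "A \<subseteq> C \<Longrightarrow> restrict (bits C S) A = bits A (S \<inter> A)"
  by (auto simp: bits_def fun_eq_iff)

lemma bij_betw_Un_Pow:
  assumes "A \<inter> B = {}"
  shows "bij_betw (\<lambda>(S, T). S \<union> T) (Pow A \<times> Pow B) (Pow (A \<union> B))"
  by (rule bij_betw_byWitness[where f' = "\<lambda>U. (U \<inter> A, U \<inter> B)"]) (use assms in auto)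

text \<open>This arranges the amplitudes as a matrix with rows indexed by \<open>Pow A\<close> and
  columns by \<open>Pow B\<close>.\<close>

lemma sum_bitstrings_Un:
  assumes "A \<inter> B = {}"
  shows "(\<Sum>x\<in>bitstrings (A \<union> B). f x) = (\<Sum>S\<in>Pow A. \<Sum>T\<in>Pow B. f (bits (A \<union> B) (S \<union> T)))"
proof -
  have "(\<Sum>x\<in>bitstrings (A \<union> B). f x) = (\<Sum>U\<in>Pow (A \<union> B). f (bits (A \<union> B) U))"
    by (rule sum.reindex_bij_betw[symmetric, OF bij_betw_bits])
  also have "\<dots> = (\<Sum>z\<in>Pow A \<times> Pow B. f (bits (A \<union> B) (case z of (S, T) \<Rightarrow> S \<union> T)))"
    by (rule sum.reindex_bij_betw[symmetric, OF bij_betw_Un_Pow[OF assms]])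
  finally show ?thesis
    by (simp add: sum.cartesian_product case_prod_unfold)
qed

lemma normalized_bits:
  assumes "normalized A \<phi>"
  shows "(\<Sum>S\<in>Pow A. (cmod (\<phi> (bits A S)))\<^sup>2) = 1"
  using assms sum.reindex_bij_betw[OF bij_betw_bits, of "\<lambda>x. (cmod (\<phi> x))\<^sup>2"]
  by (simp add: normalized_iff)

section \<open>Amplitudes of hypergraph states as signs\<close>

text \<open>This is the sign of the amplitude of the hypergraph state at the string of
  \<open>U\<close>. It is real-valued so that the Gram matrix bounds apply.\<close>

definition edge_sign :: "nat set set \<Rightarrow> nat set \<Rightarrow> real" where
  "edge_sign E U = (\<Prod>e\<in>E. if e \<subseteq> U then -1 else 1)"

lemma edge_sign_cases: "edge_sign E U = 1 \<or> edge_sign E U = -1"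
  unfolding edge_sign_def by (induction E rule: infinite_finite_induct) auto

lemma fold_CZ:
  assumes "finite E"
  shows "Finite_Set.fold CZ \<psi> E x = (\<Prod>e\<in>E. if \<forall>j\<in>e. x j = 1 then -1 else 1) * \<psi> x"
  using assms
proof (induction E arbitrary: x)
  case (insert e E)
  interpret comp_fun_commute CZ by (rule comp_fun_commute_CZ)
  have "Finite_Set.fold CZ \<psi> (insert e E) = CZ e (Finite_Set.fold CZ \<psi> E)"
    using insert by simp
  then show ?case using insert by (simp add: CZ_def[of e])
qed simp

lemma plus_state_bits: "plus_state n (bits {1..n} U) = (1 / complex_of_real (sqrt 2)) ^ n"
proof -
  have "plus_qubit (bits {1..n} U j) = 1 / complex_of_real (sqrt 2)" if "j \<in> {1..n}" for j
    using that by (auto simp: plus_qubit_def bits_def ket_def)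
  then have "plus_state n (bits {1..n} U) = (\<Prod>j\<in>{1..n}. 1 / complex_of_real (sqrt 2))"
    unfolding plus_state_def by (rule prod.cong[OF refl])
  then show ?thesis by simp
qed

lemma hypergraph_finite: "hypergraph n E \<Longrightarrow> finite E"
  by (rule finite_subset[of _ "Pow {1..n}"]) (auto simp: hypergraph_def)

text \<open>Hyperedges lie inside \<open>{1..n}\<close>, so the gates read only positions where
  \<open>bits {1..n} U\<close> records membership in \<open>U\<close>.\<close>

lemma hypergraph_state_bits:
  assumes "hypergraph n E"
  shows "hypergraph_state n E (bits {1..n} U)
    = of_real (edge_sign E U) * (1 / complex_of_real (sqrt 2)) ^ n"
proof -
  have "(\<forall>j\<in>e. bits {1..n} U j = 1) \<longleftrightarrow> e \<subseteq> U" if "e \<in> E" for e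
  proof -
    have "bits {1..n} U j = 1 \<longleftrightarrow> j \<in> U" if "j \<in> e" for j
      using assms \<open>e \<in> E\<close> that unfolding hypergraph_def bits_def by (simp add: subset_iff)
    then show ?thesis by blast
  qed
  then have "(\<Prod>e\<in>E. if \<forall>j\<in>e. bits {1..n} U j = 1 then -1 else 1 :: complex)
      = of_real (edge_sign E U)"
    unfolding edge_sign_def of_real_prod by (intro prod.cong) auto
  then show ?thesis
    unfolding hypergraph_state_def fold_CZ[OF hypergraph_finite[OF assms]] plus_state_bits by simp
qed


section \<open>Parity of a block\<close>

text \<open>An admissible \<open>Z\<close> consists of the forced part \<open>e - R\<close> and an
  arbitrary subset of \<open>e0 - (e - R)\<close>. The latter set is nonempty because
  \<open>e0\<close> is not contained in \<open>e\<close>, so the count is zero or a positive power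
  of 2.\<close>

lemma even_card_supersets:
  assumes "finite e0" "\<not> e0 \<subseteq> e"
  shows "even (card {Z\<in>Pow e0. e \<subseteq> R \<union> Z})"
proof (cases "e - R \<subseteq> e0")
  case True
  have "bij_betw (\<lambda>W. (e - R) \<union> W) (Pow (e0 - (e - R))) {Z\<in>Pow e0. e \<subseteq> R \<union> Z}"
    by (rule bij_betw_byWitness[where f' = "\<lambda>Z. Z - (e - R)"]) (use True in auto)
  then have "card {Z\<in>Pow e0. e \<subseteq> R \<union> Z} = 2 ^ card (e0 - (e - R))"
    using assms by (simp add: bij_betw_same_card[symmetric] card_Pow)
  moreover have "card (e0 - (e - R)) > 0"
    using assms by (auto simp: card_gt_0_iff)
  ultimately show ?thesis by simp
next
  case False
  then have "{Z\<in>Pow e0. e \<subseteq> R \<union> Z} = {}" by auto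
  then show ?thesis by (simp only: card.empty even_zero)
qed

text \<open>After swapping the products, each hyperedge contributes -1 to the number of sets
  \<open>Z\<close> on which it acts. By \<open>max\<close> this number is even for all hyperedges
  but \<open>e0\<close>.\<close>

lemma prod_edge_sign:
  assumes "finite E" "e0 \<in> E" "finite e0" "R \<inter> e0 = {}"
    and max: "\<And>e. e \<in> E \<Longrightarrow> e0 \<subseteq> e \<Longrightarrow> e = e0"
  shows "(\<Prod>Z\<in>Pow e0. edge_sign E (R \<union> Z)) = -1"
proof -
  have "(\<Prod>Z\<in>Pow e0. edge_sign E (R \<union> Z))
      = (\<Prod>e\<in>E. \<Prod>Z\<in>Pow e0. if e \<subseteq> R \<union> Z then -1 else 1)"
    unfolding edge_sign_def by (rule prod.swap)
  also have "\<dots> = (\<Prod>e\<in>E. (-1) ^ card {Z\<in>Pow e0. e \<subseteq> R \<union> Z})"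
    using assms by (simp add: prod.inter_filter[symmetric])
  also have "\<dots> = (\<Prod>e\<in>E. if e = e0 then -1 else 1)"
  proof (rule prod.cong[OF refl])
    fix e assume e: "e \<in> E"
    show "(-1) ^ card {Z\<in>Pow e0. e \<subseteq> R \<union> Z} = (if e = e0 then -1 else 1 :: real)"
    proof (cases "e = e0")
      case True
      \<comment> \<open>Since \<open>R\<close> misses \<open>e0\<close>, the whole of
        \<open>e0\<close> must come from \<open>Z\<close>.\<close>
      then have "{Z\<in>Pow e0. e \<subseteq> R \<union> Z} = {e0}"
        using assms by auto
      then show ?thesis
        using True by (simp only: card.insert_remove) simp
    next
      case False
      then have "even (card {Z\<in>Pow e0. e \<subseteq> R \<union> Z})"
        using max[OF e] \<open>finite e0\<close> by (intro even_card_supersets) auto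
      then show ?thesis
        using False by simp
    qed
  qed
  also have "\<dots> = -1"
    using assms by simp
  finally show ?thesis .
qed

text \<open>With the part outside \<open>e\<close> fixed to \<open>P\<close>, exactly the bits in
  \<open>A \<inter> e\<close> stay free. These fibres are the row and column sets of the
  blocks.\<close>

lemma bij_betw_fibre:
  assumes "P \<in> (\<lambda>S. S - e) ` Pow A"
  shows "bij_betw (\<lambda>X. P \<union> X) (Pow (A \<inter> e)) {S\<in>Pow A. S - e = P}"
  by (rule bij_betw_byWitness[where f' = "\<lambda>S. S \<inter> e"]) (use assms in auto)

lemma card_fibre:
  assumes "P \<in> (\<lambda>S. S - e) ` Pow A" "finite A"
  shows "card {S\<in>Pow A. S - e = P} = 2 ^ card (A \<inter> e)"
  using bij_betw_same_card[OF bij_betw_fibre[OF assms(1)]] assms(2)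
  by (simp add: card_Pow del: Pow_Int_eq)

lemma card_Diff_image_Pow:
  assumes "finite A"
  shows "card ((\<lambda>S. S - e) ` Pow A) = 2 ^ card (A - e)"
proof -
  have "(\<lambda>S. S - e) ` Pow A = Pow (A - e)"
    by (auto simp: image_iff)
  then show ?thesis using assms by (simp add: card_Pow)
qed

text \<open>As \<open>X\<close> and \<open>Y\<close> run over the free parts of rows and columns,
  \<open>X \<union> Y\<close> runs once over the subsets of \<open>e0\<close>. The block product is
  thus that of \<open>prod_edge_sign\<close> with \<open>R = P \<union> Q\<close>.\<close>

lemma prod_edge_sign_block:
  assumes "finite E" "e0 \<in> E" "finite e0" "A \<inter> B = {}" "e0 \<subseteq> A \<union> B"
    and max: "\<And>e. e \<in> E \<Longrightarrow> e0 \<subseteq> e \<Longrightarrow> e = e0"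
    and P: "P \<in> (\<lambda>S. S - e0) ` Pow A" and Q: "Q \<in> (\<lambda>S. S - e0) ` Pow B"
  shows "(\<Prod>S\<in>{S\<in>Pow A. S - e0 = P}. \<Prod>T\<in>{T\<in>Pow B. T - e0 = Q}. edge_sign E (S \<union> T)) = -1"
proof -
  have e0: "A \<inter> e0 \<union> B \<inter> e0 = e0" and disj: "(A \<inter> e0) \<inter> (B \<inter> e0) = {}"
    using assms by auto
  have "(\<Prod>S\<in>{S\<in>Pow A. S - e0 = P}. \<Prod>T\<in>{T\<in>Pow B. T - e0 = Q}. edge_sign E (S \<union> T))
      = (\<Prod>X\<in>Pow (A \<inter> e0). \<Prod>Y\<in>Pow (B \<inter> e0). edge_sign E ((P \<union> X) \<union> (Q \<union> Y)))"
    unfolding prod.reindex_bij_betw[OF bij_betw_fibre[OF P], symmetric]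
      prod.reindex_bij_betw[OF bij_betw_fibre[OF Q], symmetric] ..
  also have "\<dots> = (\<Prod>z\<in>Pow (A \<inter> e0) \<times> Pow (B \<inter> e0).
      edge_sign E ((P \<union> Q) \<union> (case z of (X, Y) \<Rightarrow> X \<union> Y)))"
    by (simp add: prod.cartesian_product case_prod_unfold Un_ac)
  also have "\<dots> = (\<Prod>Z\<in>Pow e0. edge_sign E ((P \<union> Q) \<union> Z))"
    using prod.reindex_bij_betw[OF bij_betw_Un_Pow[OF disj], of "\<lambda>Z. edge_sign E ((P \<union> Q) \<union> Z)"]
    unfolding e0 .
  also have "\<dots> = -1"
    using P Q by (intro prod_edge_sign assms max) auto
  finally show ?thesis .
qed


section \<open>The overlap bound\<close>

lemma edge_sign_bilinear_bound:
  fixes u v :: "nat set \<Rightarrow> complex"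
  assumes fin: "finite E" "finite A" "finite B" and "e0 \<in> E" "A \<inter> B = {}" "e0 \<subseteq> A \<union> B"
    and cross: "e0 \<inter> A \<noteq> {}" "e0 \<inter> B \<noteq> {}"
    and max: "\<And>e. e \<in> E \<Longrightarrow> e0 \<subseteq> e \<Longrightarrow> e = e0"
    and u: "(\<Sum>S\<in>Pow A. (cmod (u S))\<^sup>2) = 1" and v: "(\<Sum>T\<in>Pow B. (cmod (v T))\<^sup>2) = 1"
  shows "(cmod (\<Sum>S\<in>Pow A. \<Sum>T\<in>Pow B. u S * v T * of_real (edge_sign E (S \<union> T))))\<^sup>2
    \<le> 2 ^ card (A \<union> B) * (1 - 2 / 2 ^ card e0)"
proof -
  have fe: "finite e0"
    using fin \<open>e0 \<subseteq> A \<union> B\<close> finite_subset by blast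
  have ce: "card (A \<inter> e0) + card (B \<inter> e0) = card e0"
    using card_Un_disjoint[of "A \<inter> e0" "B \<inter> e0"] fin \<open>A \<inter> B = {}\<close> \<open>e0 \<subseteq> A \<union> B\<close>
    by (simp add: Int_Un_distrib2[symmetric] Int_absorb1 disjoint_iff)
  have cA: "card (A - e0) + card (A \<inter> e0) = card A" "card (B - e0) + card (B \<inter> e0) = card B"
    using card_Int_Diff[of A e0] card_Int_Diff[of B e0] fin by simp_all
  have cAB: "card (A \<union> B) = card (A - e0) + card (B - e0) + card e0"
    using card_Un_disjoint[of A B] fin \<open>A \<inter> B = {}\<close> ce cA by simp
  \<comment> \<open>Here the crossing of \<open>e0\<close> enters: it makes both side lengths of a
    block even.\<close>
  have pos: "card (A \<inter> e0) > 0" "card (B \<inter> e0) > 0"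
    using cross fin by (auto simp: card_gt_0_iff)
  have "(cmod (\<Sum>S\<in>Pow A. \<Sum>T\<in>Pow B. u S * v T * of_real (edge_sign E (S \<union> T))))\<^sup>2
    \<le> real (card ((\<lambda>S. S - e0) ` Pow A) * card ((\<lambda>S. S - e0) ` Pow B))
      * ((2 ^ card e0 - 2) * (\<Sum>S\<in>Pow A. (cmod (u S))\<^sup>2) * (\<Sum>T\<in>Pow B. (cmod (v T))\<^sup>2))"
  proof (rule fibre_bound)
    fix P Q assume P: "P \<in> (\<lambda>S. S - e0) ` Pow A" and Q: "Q \<in> (\<lambda>S. S - e0) ` Pow B"
    let ?I = "{S\<in>Pow A. S - e0 = P}" and ?J = "{T\<in>Pow B. T - e0 = Q}"
    have "real (card ?I * card ?J) = 2 ^ card e0"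
      unfolding card_fibre[OF P fin(2)] card_fibre[OF Q fin(3)] by (simp add: power_add[symmetric] ce)
    moreover have "even (card ?I)" "even (card ?J)"
      unfolding card_fibre[OF P fin(2)] card_fibre[OF Q fin(3)] using pos by simp_all
    moreover have "(\<Prod>S\<in>?I. \<Prod>T\<in>?J. edge_sign E (S \<union> T)) = -1"
      using assms fe P Q by (intro prod_edge_sign_block) auto
    ultimately show "(cmod (\<Sum>S\<in>?I. \<Sum>T\<in>?J. u S * v T * of_real (edge_sign E (S \<union> T))))\<^sup>2
        \<le> (2 ^ card e0 - 2) * (\<Sum>S\<in>?I. (cmod (u S))\<^sup>2) * (\<Sum>T\<in>?J. (cmod (v T))\<^sup>2)"
      using odd_sign_matrix_bound[of ?I ?J "\<lambda>S T. edge_sign E (S \<union> T)" u v]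
        fin edge_sign_cases by simp
  qed (use fin in auto)
  \<comment> \<open>The number of blocks times the block size \<open>2 ^ card e0\<close> is the full
    matrix size, by \<open>cAB\<close>.\<close>
  also have "\<dots> = 2 ^ card (A \<union> B) * (1 - 2 / 2 ^ card e0)"
    unfolding u v cAB using fin by (simp add: card_Diff_image_Pow power_add field_simps)
  finally show ?thesis .
qed

text \<open>The braket is the bilinear form of \<open>edge_sign\<close> times the common amplitude
  modulus; the square \<open>1 / 2 ^ n\<close> of that modulus cancels the matrix size
  \<open>2 ^ card (A \<union> B)\<close>.\<close>

lemma bipartite_overlaps_hypergraph_state_le:
  assumes "hypergraph n E" "bipartition n A B" "e0 \<in> E"
    and cross: "e0 \<inter> A \<noteq> {}" "e0 \<inter> B \<noteq> {}"
    and max: "\<And>e. e \<in> E \<Longrightarrow> e0 \<subseteq> e \<Longrightarrow> e = e0"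
    and t: "t \<in> bipartite_overlaps A B (hypergraph_state n E)"
  shows "t \<le> 1 - 2 / 2 ^ card e0"
proof -
  from t obtain \<phi> \<xi> where n: "normalized A \<phi>" "normalized B \<xi>"
    and t: "t = (cmod (braket (A \<union> B) (tensor A B \<phi> \<xi>) (hypergraph_state n E)))\<^sup>2"
    by (auto simp: bipartite_overlaps_def)
  have AB: "A \<union> B = {1..n}" "A \<inter> B = {}"
    using assms by (auto simp: bipartition_def)
  then have fin: "finite A" "finite B"
    by (metis finite_Un finite_atLeastAtMost)+
  \<comment> \<open>The conjugates come from the bra; they leave the norms unchanged.\<close>
  define u where "u S = cnj (\<phi> (bits A S))" for S
  define v where "v T = cnj (\<xi> (bits B T))" for T
  define s where "s = (\<Sum>S\<in>Pow A. \<Sum>T\<in>Pow B. u S * v T * of_real (edge_sign E (S \<union> T)))"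
  have "braket (A \<union> B) (tensor A B \<phi> \<xi>) (hypergraph_state n E)
      = (\<Sum>S\<in>Pow A. \<Sum>T\<in>Pow B. u S * v T * of_real (edge_sign E (S \<union> T))
          * (1 / complex_of_real (sqrt 2)) ^ n)"
    unfolding braket_def sum_bitstrings_Un[OF AB(2)]
  proof (intro sum.cong refl)
    fix S T assume "S \<in> Pow A" "T \<in> Pow B"
    then have "(S \<union> T) \<inter> A = S" "(S \<union> T) \<inter> B = T"
      using AB by auto
    then show "cnj (tensor A B \<phi> \<xi> (bits (A \<union> B) (S \<union> T))) * hypergraph_state n E (bits (A \<union> B) (S \<union> T))
        = u S * v T * of_real (edge_sign E (S \<union> T)) * (1 / complex_of_real (sqrt 2)) ^ n"
      using hypergraph_state_bits[OF assms(1), folded AB(1)]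
      by (simp add: tensor_def restrict_bits u_def v_def)
  qed
  also have "\<dots> = s * (1 / complex_of_real (sqrt 2)) ^ n"
    by (simp add: s_def sum_distrib_right)
  finally have "t = (cmod s)\<^sup>2 * ((1 / sqrt 2) ^ n)\<^sup>2"
    by (simp add: t norm_mult norm_power norm_divide power_mult_distrib)
  also have "((1 / sqrt 2) ^ n)\<^sup>2 = 1 / 2 ^ n"
    by (simp add: power_mult[symmetric] power_divide mult.commute[of n] power_mult)
  finally have "t = (cmod s)\<^sup>2 / 2 ^ n" by simp
  also have "(cmod s)\<^sup>2 \<le> 2 ^ card (A \<union> B) * (1 - 2 / 2 ^ card e0)"
    unfolding s_def
  proof (rule edge_sign_bilinear_bound)
    show "e0 \<subseteq> A \<union> B"
      using assms AB by (auto simp: hypergraph_def)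
    show "(\<Sum>S\<in>Pow A. (cmod (u S))\<^sup>2) = 1" "(\<Sum>T\<in>Pow B. (cmod (v T))\<^sup>2) = 1"
      using n[THEN normalized_bits] by (simp_all add: u_def v_def)
  qed (fact assms AB fin hypergraph_finite[OF assms(1)])+
  finally show ?thesis
    by (simp add: AB divide_right_mono)
qed

lemma bipartite_overlap_hypergraph_state_le:
  assumes H: "hypergraph n E" and conn: "connected_hypergraph n E" and bp: "bipartition n A B"
  shows "bipartite_overlap A B (hypergraph_state n E) \<le> 1 - 2 / 2 ^ max_cardinality E"
proof -
  note finE = hypergraph_finite[OF H]
  define M where "M = {e\<in>E. e \<inter> A \<noteq> {} \<and> e \<inter> B \<noteq> {}}"
  have "\<exists>e\<in>E. e \<inter> A \<noteq> {} \<and> e \<inter> B \<noteq> {}"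
    using conn bp by (simp add: connected_hypergraph_def)
  then have "M \<noteq> {}"
    by (auto simp: M_def)
  moreover have "finite M"
    using finE by (simp add: M_def)
  ultimately obtain e0 where e0: "e0 \<in> M" and max: "\<forall>e\<in>M. e0 \<subseteq> e \<longrightarrow> e0 = e"
    using finite_has_maximal[of M] by metis
  have "finite A" "finite B"
    using bp unfolding bipartition_def by (metis finite_Un finite_atLeastAtMost)+
  then have "bipartite_overlap A B (hypergraph_state n E)
      \<in> bipartite_overlaps A B (hypergraph_state n E)"
    by (rule bipartite_overlap_attained)
  then have "bipartite_overlap A B (hypergraph_state n E) \<le> 1 - 2 / 2 ^ card e0"
  proof (rule bipartite_overlaps_hypergraph_state_le[OF H bp, rotated -1])
    \<comment> \<open>A hyperedge containing a crossing one crosses too, so maximality in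
      \<open>M\<close> is maximality in all of \<open>E\<close>.\<close>
    fix e assume "e \<in> E" "e0 \<subseteq> e"
    then have "e \<in> M" using e0 by (auto simp: M_def)
    then show "e = e0" using max \<open>e0 \<subseteq> e\<close> by auto
  qed (use e0 in \<open>auto simp: M_def\<close>)
  also have "\<dots> \<le> 1 - 2 / 2 ^ max_cardinality E"
  proof -
    \<comment> \<open>The crossing hyperedge may be smaller than the largest one, but the bound
      grows with the cardinality.\<close>
    have "card e0 \<le> max_cardinality E"
      unfolding max_cardinality_def using e0 finE by (intro Max_ge) (auto simp: M_def)
    then show ?thesis
      by (intro diff_left_mono divide_left_mono power_increasing) auto
  qed
  finally show ?thesis .
qed

theorem mainTheorem3:
  fixes n kmax :: nat and E :: "nat set set"
  assumes "n \<ge> 2"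
    and "hypergraph n E"
    and "connected_hypergraph n E"
    and "max_cardinality E = kmax"
  shows "overlap n (hypergraph_state n E) \<le> (2 ^ (kmax - 1) - 1) / 2 ^ (kmax - 1)
    \<and> entanglement n (hypergraph_state n E) \<ge> 1 / 2 ^ (kmax - 1)"
proof -
  let ?X = "{bipartite_overlap A B (hypergraph_state n E) | A B. bipartition n A B}"
  \<comment> \<open>This bipartition shows that the set under \<open>Max\<close> is nonempty and,
    through connectedness, that some hyperedge exists.\<close>
  have bp: "bipartition n {1} {2..n}"
    using \<open>n \<ge> 2\<close> by (auto simp: bipartition_def)
  have "finite {(A, B). bipartition n A B}"
    by (rule finite_subset[of _ "Pow {1..n} \<times> Pow {1..n}"]) (auto simp: bipartition_def)
  moreover have "?X = (\<lambda>(A, B). bipartite_overlap A B (hypergraph_state n E)) ` {(A, B). bipartition n A B}"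
    by auto
  ultimately have "finite ?X" by simp
  moreover have "?X \<noteq> {}" using bp by blast
  ultimately have le: "overlap n (hypergraph_state n E) \<le> 1 - 2 / 2 ^ kmax"
    unfolding overlap_def
    using bipartite_overlap_hypergraph_state_le[OF assms(2,3)] assms(4) by (subst Max_le_iff) auto
  \<comment> \<open>Positivity keeps the natural-number subtraction \<open>kmax - 1\<close> from
    truncating, so that \<open>2 / 2 ^ kmax\<close> equals
    \<open>1 / 2 ^ (kmax - 1)\<close>.\<close>
  have "kmax > 0"
  proof -
    obtain e where e: "e \<in> E"
      using assms(3) bp by (auto simp: connected_hypergraph_def)
    then have "card e > 0"
      using assms(2) finite_subset[of e "{1..n}"] by (auto simp: hypergraph_def card_gt_0_iff)
    moreover have "card e \<le> kmax"
      using e hypergraph_finite[OF assms(2)] assms(4) by (auto simp: max_cardinality_def)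
    ultimately show ?thesis by simp
  qed
  then have "(2::real) ^ kmax = 2 * 2 ^ (kmax - 1)"
    by (simp add: power_eq_if)
  then show ?thesis
    using le by (simp add: entanglement_def diff_divide_distrib)
qed

end
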